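(* Let $\mathbb{R}^+=(0,\infty)$ and let $t$ range over a time interval; all functions below are assumed smooth. (Case $m=1$, 2D inviscid Boussinesq.) Let $\vartheta,\tilde\omega,\psi,u^z,u^r$ be functions of $(z,r,t)$, $(z,r)\in\mathbb{R}\times\mathbb{R}^+$, satisfying the 2D inviscid Boussinesq equations $$\tfrac{\mathrm D}{\mathrm Dt}\vartheta=0,\qquad \tfrac{\mathrm D}{\mathrm Dt}\tilde\omega=\partial_z\vartheta,\qquad \tilde\omega=-(\partial_z^2+\partial_r^2)\psi,\qquad u^r=-\partial_z\psi,\quad u^z=\partial_r\psi,$$ with $\tfrac{\mathrm D}{\mathrm Dt}=\partial_t+u^z\partial_z+u^r\partial_r$. Assume that there are functions $v,u,\omega,\varphi,g$ of $(z,q,t)$, $(z,q)\in\mathbb{R}\times\mathbb{R}^+$, such that, with $q=r^2$, $$v(z,r^2,t)=-\tfrac1r u^r(z,r,t),\quad u^2(z,r^2,t)=\tfrac1r\vartheta(z,r,t),\quad \omega(z,r^2,t)=\tfrac1r\tilde\omega(z,r,t),\quad \varphi(z,r^2,t)=\tfrac1r\psi(z,r,t),\quad g(z,r^2,t)=u^z(z,r,t),$$ where $u$ is a smooth square-root branch of $\Theta:=\vartheta/r$, i.e. $\Theta=u^2$ with $u$ smooth. (Case $m=2$, 3D axisymmetric Euler with swirl.) Let $v^\phi,\omega^\phi,\psi^\phi,v^z,v^r$ be functions of $(z,r,t)$, $(z,r)\in\mathbb{R}\times\mathbb{R}^+$, satisfying the 3D axisymmetric Euler equations with swirl $$\tfrac{\mathrm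 D}{\mathrm Dt}(rv^\phi)^2=0,\qquad \tfrac{\mathrm D}{\mathrm Dt}\Big(\tfrac1r\omega^\phi\Big)=\tfrac1{r^4}\partial_z(rv^\phi)^2,\qquad \omega^\phi=-\Big(\partial_z^2+\partial_r^2+\tfrac1r\partial_r-\tfrac1{r^2}\Big)\psi^\phi,$$ $$v^r=-\tfrac1r\partial_z(r\psi^\phi),\qquad v^z=\tfrac1r\partial_r(r\psi^\phi),$$ with $\tfrac{\mathrm D}{\mathrm Dt}=\partial_t+v^z\partial_z+v^r\partial_r$. Assume that there are functions $v,u,\omega,\varphi,g$ of $(z,q,t)$, $(z,q)\in\mathbb{R}\times\mathbb{R}^+$, such that, with $q=r^2$, $$v(z,r^2,t)=-\tfrac1r v^r(z,r,t),\quad u(z,r^2,t)=\tfrac1r v^\phi(z,r,t),\quad \omega(z,r^2,t)=\tfrac1r\omega^\phi(z,r,t),\quad \varphi(z,r^2,t)=\tfrac1r\psi^\phi(z,r,t),\quad g(z,r^2,t)=v^z(z,r,t).$$ Then, in case $m=1$ and in case $m=2$ respectively, the equations are transformed into the following single system with the corresponding value of $m$, i.e. the functions $u,\omega,\varphi,v,g$ of $(z,q,t)$, $(z,q)\in\mathbb{R}\times\mathbb{R}^+$, satisfy $$\begin{aligned} &\tfrac{\mathrm D}{\mathrm Dt}u=\tfrac{m^2}{2}uv,\\ &\tfrac{\mathrm D}{\mathrm Dt}\omega=(u^2)_z+(2-m)v\omega,\\ &\omega=-\big(\partial_z^2+4q\,\partial_q^2+(4+2m)\partial_q\big)\varphi,\\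 &v=\varphi_z,\qquad g=m\varphi+2q\varphi_q,\\ &\tfrac{\mathrm D}{\mathrm Dt}:=\partial_t+g\,\partial_z-2vq\,\partial_q . \end{aligned}$$
   Context: Subscripts $z,q$ denote partial derivatives. Superscripts $z,r,\phi$ on $u^z,u^r,v^z,v^r,v^\phi,\omega^\phi,\psi^\phi$ are component labels (cylindrical coordinates $(z,r,\phi)$), whereas $u^2$ denotes the square of $u$. The unified system is called $(Bm)$; $(B1)$ is the reformulated 2D Boussinesq system and $(B2)$ the reformulated 3D axisymmetric Euler system. In the Boussinesq case, instead of the square-root notation one may equivalently keep the scalar $\Theta=\vartheta/r$ (as a function of $(z,q,t)$, $q=r^2$), for which the first two equations read $\tfrac{\mathrm D}{\mathrm Dt}\Theta=v\Theta$ and $\tfrac{\mathrm D}{\mathrm Dt}\omega=\Theta_z+v\omega$; when $\Theta=u^2$ the first of these is equivalent to $\tfrac{\mathrm D}{\mathrm Dt}u=\tfrac12uv$. *)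

theory Defs
  imports "HOL-Analysis.Analysis"
begin

text \<open>
  \<open>C\<^sup>k\<close> regularity on a set \<open>S\<close>, with derivatives taken within \<open>S\<close>. It is meant for sets on which
  these derivatives are unique, e.g. convex sets with nonempty interior; this allows time
  intervals that contain an endpoint. In finite dimension, continuity of all directional
  components \<open>x \<mapsto> Df(x) h\<close> is the same as continuity of \<open>Df\<close> in operator norm, so the recursion
  on the components gives the usual class.
\<close>

primrec Ck_on :: "nat \<Rightarrow> ('a::euclidean_space \<Rightarrow> 'b::real_normed_vector) \<Rightarrow> 'a set \<Rightarrow> bool" where
  "Ck_on 0 f S \<longleftrightarrow> continuous_on S f"
| "Ck_on (Suc k) f S \<longleftrightarrow>
     f differentiable_on S \<and> (\<forall>h. Ck_on k (\<lambda>x. frechet_derivative f (at x within S) h) S)"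

definition smooth_on :: "('a::euclidean_space \<Rightarrow> 'b::real_normed_vector) \<Rightarrow> 'a set \<Rightarrow> bool" where
  "smooth_on f S \<longleftrightarrow> (\<forall>k. Ck_on k f S)"

text \<open>
  A scalar field is a curried function of \<open>(z, y, t)\<close>, where \<open>y\<close> is either \<open>r\<close> or \<open>q = r\<^sup>2\<close>. Only
  its values for \<open>y > 0\<close> and \<open>t \<in> T\<close> are relevant.
\<close>

type_synonym field = "real \<Rightarrow> real \<Rightarrow> real \<Rightarrow> real"

definition smooth_field :: "real set \<Rightarrow> field \<Rightarrow> bool" where
  "smooth_field T f \<longleftrightarrow> smooth_on (\<lambda>(z, y, t). f z y t) (UNIV \<times> {0<..} \<times> T)"

definition D1 :: "field \<Rightarrow> field" where
  "D1 f z y t = deriv (\<lambda>x. f x y t) z"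

definition D2 :: "field \<Rightarrow> field" where
  "D2 f z y t = deriv (\<lambda>x. f z x t) y"

text \<open>The time derivative is taken within \<open>T\<close>, hence one-sided at an endpoint belonging to \<open>T\<close>.\<close>

definition Dt :: "real set \<Rightarrow> field \<Rightarrow> field" where
  "Dt T f z y t = vector_derivative (\<lambda>s. f z y s) (at t within T)"

definition transport :: "real set \<Rightarrow> field \<Rightarrow> field \<Rightarrow> field \<Rightarrow> field" where
  "transport T a b f z y t = Dt T f z y t + a z y t * D1 f z y t + b z y t * D2 f z y t"

text \<open>The 2D inviscid Boussinesq equations; \<open>w\<close> is the vorticity \<open>\<omega>\<tilde>\<close>.\<close>

definition boussinesq_2d :: "real set \<Rightarrow> field \<Rightarrow> field \<Rightarrow> field \<Rightarrow> field \<Rightarrow> field \<Rightarrow> bool" where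
  "boussinesq_2d T \<theta> w \<psi> uz ur \<longleftrightarrow>
    (\<forall>z. \<forall>r>0. \<forall>t\<in>T.
       transport T uz ur \<theta> z r t = 0 \<and>
       transport T uz ur w z r t = D1 \<theta> z r t \<and>
       w z r t = - (D1 (D1 \<psi>) z r t + D2 (D2 \<psi>) z r t) \<and>
       ur z r t = - D1 \<psi> z r t \<and>
       uz z r t = D2 \<psi> z r t)"

text \<open>
  The 3D axisymmetric Euler equations with swirl; \<open>v\<phi>, w\<phi>, \<psi>\<phi>\<close> are the angular components of
  velocity, vorticity and vector stream function.
\<close>

definition axisym_euler_3d :: "real set \<Rightarrow> field \<Rightarrow> field \<Rightarrow> field \<Rightarrow> field \<Rightarrow> field \<Rightarrow> bool" where
  "axisym_euler_3d T v\<phi> w\<phi> \<psi>\<phi> vz vr \<longleftrightarrow>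
    (\<forall>z. \<forall>r>0. \<forall>t\<in>T.
       transport T vz vr (\<lambda>z r t. (r * v\<phi> z r t)\<^sup>2) z r t = 0 \<and>
       transport T vz vr (\<lambda>z r t. 1 / r * w\<phi> z r t) z r t
         = 1 / r ^ 4 * D1 (\<lambda>z r t. (r * v\<phi> z r t)\<^sup>2) z r t \<and>
       w\<phi> z r t = - (D1 (D1 \<psi>\<phi>) z r t + D2 (D2 \<psi>\<phi>) z r t
                      + 1 / r * D2 \<psi>\<phi> z r t - 1 / r\<^sup>2 * \<psi>\<phi> z r t) \<and>
       vr z r t = - (1 / r) * D1 (\<lambda>z r t. r * \<psi>\<phi> z r t) z r t \<and>
       vz z r t = 1 / r * D2 (\<lambda>z r t. r * \<psi>\<phi> z r t) z r t)"

text \<open>The unified system \<open>(Bm)\<close>; the second space variable is \<open>q\<close>, so \<open>D2\<close> is \<open>\<partial>\<^sub>q\<close>.\<close>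

definition unified_system :: "nat \<Rightarrow> real set \<Rightarrow> field \<Rightarrow> field \<Rightarrow> field \<Rightarrow> field \<Rightarrow> field \<Rightarrow> bool" where
  "unified_system m T u \<omega> \<phi> v g \<longleftrightarrow>
    (let DDt = transport T g (\<lambda>z q t. - 2 * v z q t * q) in
     \<forall>z. \<forall>q>0. \<forall>t\<in>T.
       DDt u z q t = (real m)\<^sup>2 / 2 * u z q t * v z q t \<and>
       DDt \<omega> z q t = D1 (\<lambda>z q t. (u z q t)\<^sup>2) z q t + (2 - real m) * v z q t * \<omega> z q t \<and>
       \<omega> z q t = - (D1 (D1 \<phi>) z q t + 4 * q * D2 (D2 \<phi>) z q t + (4 + 2 * real m) * D2 \<phi> z q t) \<and>
       v z q t = D1 \<phi> z q t \<and>
       g z q t = real m * \<phi> z q t + 2 * q * D2 \<phi> z q t)"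

end

theory Submission
  imports Defs
begin

text \<open>
  Up to sign, every relation between the old and the new fields says that a field of the
  variables \<open>(z, r, t)\<close>, or a product of one with powers of \<open>r\<close>, equals
  \<open>r ^ k * F z (r\<^sup>2) t\<close> for a field \<open>F\<close> of the variables \<open>(z, q, t)\<close>. The chain rule expresses
  \<open>\<partial>\<^sub>z\<close>, \<open>\<partial>\<^sub>r\<close> and \<open>\<partial>\<^sub>t\<close> of such a field through the derivatives of \<open>F\<close>; since the radial velocity
  is \<open>- r v\<close> in both models, the material derivative becomes
  \<open>r ^ k * (DF/Dt - k v F)\<close>, where \<open>D/Dt\<close> on the right is the operator of the unified
  system (lemma \<open>transport_radial_power\<close>). In the transport equations the two models differ only
  in the exponents: the conserved quantity (\<open>\<theta>\<close>, respectively \<open>(r v\<^sup>\<phi>)\<^sup>2\<close>) is \<open>r ^ k * u\<^sup>2\<close> with \<open>k = m\<^sup>2\<close>, and the vorticity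
  quantity (\<open>\<omega>\<tilde>\<close>, respectively \<open>\<omega>\<^sup>\<phi> / r\<close>) is \<open>r ^ k * \<omega>\<close> with \<open>k = 2 - m\<close>. The terms
  \<open>k v F\<close> produce the coefficients \<open>m\<^sup>2 / 2\<close> (halved on passing from \<open>u\<^sup>2\<close> to \<open>u\<close>) and \<open>2 - m\<close> of the
  unified system. The equations for \<open>\<omega>\<close>, \<open>v\<close> and \<open>g\<close> in terms of \<open>\<phi>\<close> follow from the first and
  second derivatives of \<open>\<psi> = r \<phi>\<close>.

  The one point that is not a computation is the equation for \<open>u\<close>. The chain rule gives it only
  after multiplication by \<open>2 u\<close>, so it may fail a priori on the zero set of \<open>u\<close>. Suppose that
  the defect \<open>Du/Dt - m\<^sup>2/2 u v\<close> is nonzero at some point. By continuity it is nonzero nearby,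
  hence \<open>u\<close> vanishes nearby, hence so do all first derivatives of \<open>u\<close> at the point, and the
  defect is zero there after all (lemma \<open>cancel_factor\<close>).
\<close>

section \<open>Partial derivatives of smooth fields\<close>

abbreviation half_space :: "real set \<Rightarrow> (real \<times> real \<times> real) set" where
  "half_space T \<equiv> UNIV \<times> {0<..} \<times> T"

abbreviation uncurried :: "field \<Rightarrow> real \<times> real \<times> real \<Rightarrow> real" where
  "uncurried f \<equiv> \<lambda>(z, y, t). f z y t"

lemma has_derivative_within_cong:
  assumes "\<And>x. x \<in> S \<Longrightarrow> f x = g x" "x \<in> S"
  shows "(f has_derivative D) (at x within S) \<longleftrightarrow> (g has_derivative D) (at x within S)"
  using assms has_derivative_transform[of x S f g D] has_derivative_transform[of x S g f D]
  by auto

text \<open>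
  The partial derivatives of a field agree with components of its Frechet derivative only inside
  the domain, so carrying smoothness over to them requires congruence on the domain.
\<close>

lemma Ck_on_cong:
  assumes "\<And>x. x \<in> S \<Longrightarrow> f x = g x"
  shows "Ck_on k f S \<longleftrightarrow> Ck_on k g S"
  using assms
proof (induction k arbitrary: f g)
  case 0
  then show ?case
    by (simp cong: continuous_on_cong)
next
  case (Suc k)
  note cong = has_derivative_within_cong[of S f g, OF Suc.prems]
  have "f differentiable_on S \<longleftrightarrow> g differentiable_on S"
    by (simp add: differentiable_on_def differentiable_def cong)
  moreover have "Ck_on k (\<lambda>x. frechet_derivative f (at x within S) h) S \<longleftrightarrow>
      Ck_on k (\<lambda>x. frechet_derivative g (at x within S) h) S" for h
    by (rule Suc.IH) (simp add: frechet_derivative_def cong)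
  ultimately show ?case
    by simp
qed

lemma smooth_on_cong:
  assumes "\<And>x. x \<in> S \<Longrightarrow> f x = g x"
  shows "smooth_on f S \<longleftrightarrow> smooth_on g S"
  using Ck_on_cong[of S f g, OF assms] by (simp add: smooth_on_def)

lemma smooth_on_frechet_derivative:
  assumes "smooth_on f S"
  shows "smooth_on (\<lambda>x. frechet_derivative f (at x within S) h) S"
  using assms unfolding smooth_on_def by (metis Ck_on.simps(2))

lemma smooth_field_continuous:
  assumes "smooth_field T f"
  shows "continuous_on (half_space T) (uncurried f)"
  using assms unfolding smooth_field_def smooth_on_def by (metis Ck_on.simps(1))

text \<open>
  Along the three coordinate axes this identifies \<open>D1\<close>, \<open>D2\<close> and \<open>Dt\<close>, which are defined by
  one-dimensional derivatives, with components of the Frechet derivative, because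
  one-dimensional derivatives are unique. Smoothness of a field controls only the latter.
\<close>

lemma smooth_field_has_derivative_along:
  fixes c :: "real \<Rightarrow> real \<times> real \<times> real"
  assumes "smooth_field T f" "c s \<in> half_space T" "c ` I \<subseteq> half_space T"
    and c: "\<And>s. (c has_derivative (\<lambda>h. h *\<^sub>R d)) (at s within I)"
  shows "((\<lambda>s. uncurried f (c s)) has_vector_derivative
      frechet_derivative (uncurried f) (at (c s) within half_space T) d) (at s within I)"
proof -
  let ?D = "frechet_derivative (uncurried f) (at (c s) within half_space T)"
  have "Ck_on 1 (uncurried f) (half_space T)"
    using assms unfolding smooth_field_def smooth_on_def by blast
  then have "uncurried f differentiable (at (c s) within half_space T)"
    using assms(2) by (auto simp: differentiable_on_def simp del: split_paired_All mem_Times_iff)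
  then have D: "(uncurried f has_derivative ?D) (at (c s) within half_space T)"
    by (simp add: frechet_derivative_works)
  have "((\<lambda>s. uncurried f (c s)) has_derivative (\<lambda>h. ?D (h *\<^sub>R d))) (at s within I)"
    using has_derivative_in_compose[OF c has_derivative_subset[OF D assms(3)]] by simp
  moreover have "?D (h *\<^sub>R d) = h *\<^sub>R ?D d" for h
    using has_derivative_linear[OF D] by (rule linear_scale)
  ultimately show ?thesis
    by (simp add: has_vector_derivative_def)
qed

lemma smooth_field_partials:
  fixes z y t :: real
  assumes f: "smooth_field T f" and "y > 0" "t \<in> T" and T: "at t within T \<noteq> bot"
  defines "D \<equiv> frechet_derivative (uncurried f) (at (z, y, t) within half_space T)"
  shows "((\<lambda>x. f x y t) has_real_derivative D1 f z y t) (at z)"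
    and "D1 f z y t = D (1, 0, 0)"
    and "((\<lambda>x. f z x t) has_real_derivative D2 f z y t) (at y)"
    and "D2 f z y t = D (0, 1, 0)"
    and "((\<lambda>s. f z y s) has_vector_derivative Dt T f z y t) (at t within T)"
    and "Dt T f z y t = D (0, 0, 1)"
proof -
  have "range (\<lambda>x. (x, y, t)) \<subseteq> half_space T"
    using \<open>y > 0\<close> \<open>t \<in> T\<close> by auto
  moreover have "((\<lambda>x. (x, y, t)) has_derivative (\<lambda>h. h *\<^sub>R (1, 0, 0))) (at z)" for z
    by (auto intro!: derivative_eq_intros simp: zero_prod_def)
  ultimately have "((\<lambda>x. f x y t) has_vector_derivative D (1, 0, 0)) (at z)"
    using smooth_field_has_derivative_along[OF f, of "\<lambda>x. (x, y, t)" z UNIV "(1, 0, 0)"]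
      \<open>y > 0\<close> \<open>t \<in> T\<close> by (simp add: D_def)
  then have 1: "((\<lambda>x. f x y t) has_real_derivative D (1, 0, 0)) (at z)"
    by (simp add: has_real_derivative_iff_has_vector_derivative)
  then show "D1 f z y t = D (1, 0, 0)"
    unfolding D1_def by (rule DERIV_imp_deriv)
  with 1 show "((\<lambda>x. f x y t) has_real_derivative D1 f z y t) (at z)"
    by simp
  have "(\<lambda>x. (z, x, t)) ` {0<..} \<subseteq> half_space T"
    using \<open>t \<in> T\<close> by auto
  moreover have "((\<lambda>x. (z, x, t)) has_derivative (\<lambda>h. h *\<^sub>R (0, 1, 0))) (at y within {0<..})" for y
    by (auto intro!: derivative_eq_intros simp: zero_prod_def)
  ultimately have "((\<lambda>x. f z x t) has_vector_derivative D (0, 1, 0)) (at y within {0<..})"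
    using smooth_field_has_derivative_along[OF f, of "\<lambda>x. (z, x, t)" y "{0<..}" "(0, 1, 0)"]
      \<open>y > 0\<close> \<open>t \<in> T\<close> by (simp add: D_def)
  then have 2: "((\<lambda>x. f z x t) has_real_derivative D (0, 1, 0)) (at y)"
    using \<open>y > 0\<close> at_within_open[of y "{0<..}"]
    by (simp add: has_real_derivative_iff_has_vector_derivative)
  then show "D2 f z y t = D (0, 1, 0)"
    unfolding D2_def by (rule DERIV_imp_deriv)
  with 2 show "((\<lambda>x. f z x t) has_real_derivative D2 f z y t) (at y)"
    by simp
  have "(\<lambda>s. (z, y, s)) ` T \<subseteq> half_space T"
    using \<open>y > 0\<close> by auto
  moreover have "((\<lambda>s. (z, y, s)) has_derivative (\<lambda>h. h *\<^sub>R (0, 0, 1))) (at t within T)" for t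
    by (auto intro!: derivative_eq_intros simp: zero_prod_def)
  ultimately have 3: "((\<lambda>s. f z y s) has_vector_derivative D (0, 0, 1)) (at t within T)"
    using smooth_field_has_derivative_along[OF f, of "\<lambda>s. (z, y, s)" t T "(0, 0, 1)"]
      \<open>y > 0\<close> \<open>t \<in> T\<close> by (simp add: D_def)
  then show "Dt T f z y t = D (0, 0, 1)"
    unfolding Dt_def using T by (rule vector_derivative_within[rotated])
  with 3 show "((\<lambda>s. f z y s) has_vector_derivative Dt T f z y t) (at t within T)"
    by simp
qed

lemma smooth_field_frechet_derivative:
  assumes "smooth_field T f"
    and "\<And>z y t. y > 0 \<Longrightarrow> t \<in> T \<Longrightarrow>
      g z y t = frechet_derivative (uncurried f) (at (z, y, t) within half_space T) d"
  shows "smooth_field T g"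
proof -
  let ?D = "\<lambda>x. frechet_derivative (uncurried f) (at x within half_space T) d"
  have "uncurried g x = ?D x" if "x \<in> half_space T" for x
    using that assms(2) by (cases x) simp
  then have "smooth_on (uncurried g) (half_space T) \<longleftrightarrow> smooth_on ?D (half_space T)"
    by (rule smooth_on_cong)
  moreover have "smooth_on ?D (half_space T)"
    using assms(1) unfolding smooth_field_def by (rule smooth_on_frechet_derivative)
  ultimately show ?thesis
    by (simp add: smooth_field_def)
qed

lemma smooth_field_D1_D2_Dt:
  assumes f: "smooth_field T f" and T: "\<And>t. t \<in> T \<Longrightarrow> at t within T \<noteq> bot"
  shows "smooth_field T (D1 f)" "smooth_field T (D2 f)" "smooth_field T (Dt T f)"
proof -
  show "smooth_field T (D1 f)"
    by (rule smooth_field_frechet_derivative[OF f smooth_field_partials(2)[OF f _ _ T]])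
  show "smooth_field T (D2 f)"
    by (rule smooth_field_frechet_derivative[OF f smooth_field_partials(4)[OF f _ _ T]])
  show "smooth_field T (Dt T f)"
    by (rule smooth_field_frechet_derivative[OF f smooth_field_partials(6)[OF f _ _ T]])
qed

text \<open>
  The change of variables applies to \<open>u\<^sup>2\<close> as well as to \<open>\<omega>\<close> and \<open>\<phi>\<close>, and it involves first partial
  derivatives only. Existence of these passes to \<open>u\<^sup>2\<close> by the product rule, whereas smoothness of
  \<open>u\<^sup>2\<close> would require an induction over derivatives of all orders.
\<close>

definition has_partials :: "real set \<Rightarrow> field \<Rightarrow> bool" where
  "has_partials T f \<longleftrightarrow> (\<forall>z. \<forall>y>0. \<forall>t\<in>T.
     ((\<lambda>x. f x y t) has_real_derivative D1 f z y t) (at z) \<and>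
     ((\<lambda>x. f z x t) has_real_derivative D2 f z y t) (at y) \<and>
     ((\<lambda>s. f z y s) has_vector_derivative Dt T f z y t) (at t within T))"

lemma has_partialsD:
  assumes "has_partials T f" "y > 0" "t \<in> T"
  shows "((\<lambda>x. f x y t) has_real_derivative D1 f z y t) (at z)"
    and "((\<lambda>x. f z x t) has_real_derivative D2 f z y t) (at y)"
    and "((\<lambda>s. f z y s) has_vector_derivative Dt T f z y t) (at t within T)"
  using assms by (auto simp: has_partials_def)

lemma smooth_field_has_partials:
  assumes "smooth_field T f" "\<And>t. t \<in> T \<Longrightarrow> at t within T \<noteq> bot"
  shows "has_partials T f"
  using smooth_field_partials(1,3,5)[OF assms(1)] assms(2) by (simp add: has_partials_def)

lemma partials_square:
  assumes "has_partials T u" "y > 0" "t \<in> T" "at t within T \<noteq> bot"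
  shows "((\<lambda>x. (u x y t)\<^sup>2) has_real_derivative 2 * u z y t * D1 u z y t) (at z)"
    and "D1 (\<lambda>z y t. (u z y t)\<^sup>2) z y t = 2 * u z y t * D1 u z y t"
    and "((\<lambda>x. (u z x t)\<^sup>2) has_real_derivative 2 * u z y t * D2 u z y t) (at y)"
    and "D2 (\<lambda>z y t. (u z y t)\<^sup>2) z y t = 2 * u z y t * D2 u z y t"
    and "((\<lambda>s. (u z y s)\<^sup>2) has_vector_derivative 2 * u z y t * Dt T u z y t) (at t within T)"
    and "Dt T (\<lambda>z y t. (u z y t)\<^sup>2) z y t = 2 * u z y t * Dt T u z y t"
proof -
  note d = has_partialsD[OF assms(1-3)]
  show 1: "((\<lambda>x. (u x y t)\<^sup>2) has_real_derivative 2 * u z y t * D1 u z y t) (at z)"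
    by (auto intro!: derivative_eq_intros d)
  show 2: "((\<lambda>x. (u z x t)\<^sup>2) has_real_derivative 2 * u z y t * D2 u z y t) (at y)"
    by (auto intro!: derivative_eq_intros d)
  show 3: "((\<lambda>s. (u z y s)\<^sup>2) has_vector_derivative 2 * u z y t * Dt T u z y t) (at t within T)"
    using has_vector_derivative_mult[OF d(3) d(3), of z z]
    by (simp add: algebra_simps power2_eq_square)
  show "D1 (\<lambda>z y t. (u z y t)\<^sup>2) z y t = 2 * u z y t * D1 u z y t"
    unfolding D1_def[of "\<lambda>z y t. (u z y t)\<^sup>2"] by (rule DERIV_imp_deriv[OF 1])
  show "D2 (\<lambda>z y t. (u z y t)\<^sup>2) z y t = 2 * u z y t * D2 u z y t"
    unfolding D2_def[of "\<lambda>z y t. (u z y t)\<^sup>2"] by (rule DERIV_imp_deriv[OF 2])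
  show "Dt T (\<lambda>z y t. (u z y t)\<^sup>2) z y t = 2 * u z y t * Dt T u z y t"
    unfolding Dt_def[of T "\<lambda>z y t. (u z y t)\<^sup>2"] by (rule vector_derivative_within[OF assms(4) 3])
qed

lemma has_partials_square:
  assumes "has_partials T u" "\<And>t. t \<in> T \<Longrightarrow> at t within T \<noteq> bot"
  shows "has_partials T (\<lambda>z y t. (u z y t)\<^sup>2)"
  using partials_square[OF assms(1)] assms(2) by (simp add: has_partials_def)

section \<open>Cancelling a factor in the transport equation\<close>

lemma transport_square:
  assumes "has_partials T u" "q > 0" "t \<in> T" "at t within T \<noteq> bot"
  shows "transport T a b (\<lambda>z q t. (u z q t)\<^sup>2) z q t = 2 * u z q t * transport T a b u z q t"
  using partials_square[OF assms] by (simp add: transport_def algebra_simps)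

lemma transport_eq_0_if_locally_0:
  assumes "d > 0" "q > 0" "t \<in> T" "at t within T \<noteq> bot"
    and u: "\<And>p. p \<in> half_space T \<Longrightarrow> dist p (z, q, t) < d \<Longrightarrow> uncurried u p = 0"
  shows "transport T a b u z q t = 0"
proof -
  have "((\<lambda>x. u x q t) has_real_derivative 0) (at z)"
    by (rule has_field_derivative_transform_within[OF DERIV_const[of 0] \<open>d > 0\<close>])
      (use u[of "(_, q, t)"] assms in \<open>auto simp: dist_Pair_Pair\<close>)
  moreover have "((\<lambda>x. u z x t) has_real_derivative 0) (at q)"
    by (rule has_field_derivative_transform_within[OF DERIV_const[of 0], of "min d q"])
      (use u[of "(z, _, t)"] assms in \<open>auto simp: dist_Pair_Pair dist_real_def\<close>)
  moreover have "((\<lambda>s. u z q s) has_vector_derivative 0) (at t within T)"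
    by (rule has_vector_derivative_transform_within[OF has_vector_derivative_const[of 0] \<open>d > 0\<close>])
      (use u[of "(z, q, _)"] assms in \<open>auto simp: dist_Pair_Pair\<close>)
  ultimately show ?thesis
    using assms(4)
    by (simp add: transport_def D1_def D2_def Dt_def DERIV_imp_deriv vector_derivative_within)
qed

text \<open>
  This passes from the equation for \<open>u\<^sup>2\<close> to the equation for \<open>u\<close> also at the zeros of \<open>u\<close>. A point of
  the zero set that is a limit of points with \<open>u \<noteq> 0\<close> inherits the equation by continuity, and at
  any other zero \<open>u\<close> vanishes nearby.
\<close>

lemma cancel_factor:
  assumes T: "\<And>t. t \<in> T \<Longrightarrow> at t within T \<noteq> bot"
    and smooth: "smooth_field T u" "smooth_field T a" "smooth_field T v"
    and eq: "\<And>z q t. q > 0 \<Longrightarrow> t \<in> T \<Longrightarrow>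
      transport T a (\<lambda>z q t. - 2 * v z q t * q) (\<lambda>z q t. (u z q t)\<^sup>2) z q t
        = c * v z q t * (u z q t)\<^sup>2"
    and "q > 0" "t \<in> T"
  shows "transport T a (\<lambda>z q t. - 2 * v z q t * q) u z q t = c / 2 * u z q t * v z q t"
proof -
  define b where "b = (\<lambda>z q t. - 2 * v z q t * q)"
  define F where "F = (\<lambda>z q t. transport T a b u z q t - c / 2 * u z q t * v z q t)"
  have uF: "u z q t * F z q t = 0" if "q > 0" "t \<in> T" for z q t
  proof -
    have "2 * u z q t * transport T a b u z q t = c * v z q t * (u z q t)\<^sup>2"
      using transport_square[OF smooth_field_has_partials[OF smooth(1) T] that T, of a b z]
        eq[OF that, of z] that by (simp add: b_def)
    then show ?thesis
      by (simp only: F_def) algebra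
  qed
  have "continuous_on (half_space T) (uncurried F)"
    using smooth_field_D1_D2_Dt[OF smooth(1) T, THEN smooth_field_continuous]
      smooth[THEN smooth_field_continuous]
    unfolding F_def b_def transport_def case_prod_beta by (intro continuous_intros)
  have "F z q t = 0"
  proof (rule ccontr)
    assume nz: "F z q t \<noteq> 0"
    have "(z, q, t) \<in> half_space T"
      using \<open>q > 0\<close> \<open>t \<in> T\<close> by simp
    with \<open>continuous_on _ _\<close> nz obtain d where "d > 0"
      and d: "\<And>p. p \<in> half_space T \<Longrightarrow> dist p (z, q, t) < d \<Longrightarrow>
        dist (uncurried F p) (F z q t) < \<bar>F z q t\<bar>"
      unfolding continuous_on_iff by (metis case_prod_conv zero_less_abs_iff)
    have u0: "uncurried u p = 0" if "p \<in> half_space T" "dist p (z, q, t) < d" for p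
    proof -
      have "uncurried F p \<noteq> 0"
        using d[OF that] by (auto simp: dist_real_def)
      with that uF show ?thesis
        by (cases p) auto
    qed
    have "transport T a b u z q t = 0"
      using transport_eq_0_if_locally_0[OF \<open>d > 0\<close> \<open>q > 0\<close> \<open>t \<in> T\<close> T u0] \<open>t \<in> T\<close> by blast
    moreover have "u z q t = 0"
      using u0[of "(z, q, t)"] \<open>(z, q, t) \<in> _\<close> \<open>d > 0\<close> by simp
    ultimately show False
      using nz by (simp add: F_def)
  qed
  then show ?thesis
    by (simp add: F_def b_def)
qed

section \<open>The change of variables\<close>

definition radial_power :: "nat \<Rightarrow> real set \<Rightarrow> field \<Rightarrow> field \<Rightarrow> bool" where
  "radial_power k T f F \<longleftrightarrow> (\<forall>z. \<forall>r>0. \<forall>t\<in>T. f z r t = r ^ k * F z (r\<^sup>2) t)"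

lemma radial_power_D1:
  assumes "has_partials T F" "radial_power k T f F"
  shows "radial_power k T (D1 f) (D1 F)"
  unfolding radial_power_def
proof (intro allI impI ballI)
  fix z r t :: real
  assume "r > 0" "t \<in> T"
  have "(\<lambda>x. f x r t) = (\<lambda>x. r ^ k * F x (r\<^sup>2) t)"
    using assms(2) \<open>r > 0\<close> \<open>t \<in> T\<close> by (simp add: radial_power_def)
  then have "((\<lambda>x. f x r t) has_real_derivative r ^ k * D1 F z (r\<^sup>2) t) (at z)"
    using has_partialsD(1)[of T F "r\<^sup>2" t z] assms \<open>r > 0\<close> \<open>t \<in> T\<close>
    by (auto intro: DERIV_cmult)
  then show "D1 f z r t = r ^ k * D1 F z (r\<^sup>2) t"
    unfolding D1_def[of f] by (rule DERIV_imp_deriv)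
qed

lemma radial_power_Dt:
  assumes "has_partials T F" "\<And>t. t \<in> T \<Longrightarrow> at t within T \<noteq> bot" "radial_power k T f F"
  shows "radial_power k T (Dt T f) (Dt T F)"
  unfolding radial_power_def
proof (intro allI impI ballI)
  fix z r t :: real
  assume "r > 0" "t \<in> T"
  have "((\<lambda>s. r ^ k * F z (r\<^sup>2) s) has_vector_derivative r ^ k * Dt T F z (r\<^sup>2) t) (at t within T)"
    using has_partialsD(3)[of T F "r\<^sup>2" t z] assms \<open>r > 0\<close> \<open>t \<in> T\<close>
    by (auto intro: has_vector_derivative_mult_right)
  then have "((\<lambda>s. f z r s) has_vector_derivative r ^ k * Dt T F z (r\<^sup>2) t) (at t within T)"
    by (rule has_vector_derivative_transform[rotated 2])
      (use assms(3) \<open>r > 0\<close> \<open>t \<in> T\<close> in \<open>auto simp: radial_power_def\<close>)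
  then show "Dt T f z r t = r ^ k * Dt T F z (r\<^sup>2) t"
    unfolding Dt_def[of T f] using assms(2) \<open>t \<in> T\<close> by (intro vector_derivative_within) auto
qed

lemma has_derivative_radial:
  assumes "has_partials T F" "r > 0" "t \<in> T"
  shows "((\<lambda>r. F z (r\<^sup>2) t) has_real_derivative 2 * r * D2 F z (r\<^sup>2) t) (at r)"
proof -
  have "((\<lambda>r. r\<^sup>2) has_real_derivative 2 * r) (at r)"
    by (auto intro!: derivative_eq_intros)
  moreover have "((\<lambda>x. F z x t) has_real_derivative D2 F z (r\<^sup>2) t) (at (r\<^sup>2))"
    using has_partialsD(2)[of T F "r\<^sup>2" t z] assms by simp
  ultimately show ?thesis
    using DERIV_chain2[of "\<lambda>x. F z x t"] by (fastforce simp: mult_ac)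
qed

lemma D2_eqI:
  assumes "\<And>r. r > 0 \<Longrightarrow> f z r t = h r" "r > 0" "(h has_real_derivative D) (at r)"
  shows "D2 f z r t = D"
  unfolding D2_def
  by (intro DERIV_imp_deriv has_field_derivative_transform_within_open[OF assms(3), of "{0<..}"])
    (use assms in auto)

text \<open>
  For \<open>k = 0\<close> the truncated exponent \<open>k - 1\<close> is harmless, because the term has the factor \<open>k\<close>.
\<close>

lemma radial_power_D2:
  assumes "has_partials T F" "radial_power k T f F" "r > 0" "t \<in> T"
  shows "D2 f z r t = real k * r ^ (k - 1) * F z (r\<^sup>2) t + 2 * r ^ (k + 1) * D2 F z (r\<^sup>2) t"
proof (rule D2_eqI)
  show "f z r t = r ^ k * F z (r\<^sup>2) t" if "r > 0" for r
    using that assms by (simp add: radial_power_def)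
  show "((\<lambda>r. r ^ k * F z (r\<^sup>2) t) has_real_derivative
      real k * r ^ (k - 1) * F z (r\<^sup>2) t + 2 * r ^ (k + 1) * D2 F z (r\<^sup>2) t) (at r)"
    using DERIV_mult[OF DERIV_pow[of k] has_derivative_radial[OF assms(1,3,4), of z]]
    by (simp add: algebra_simps)
qed fact

text \<open>
  The radial velocity \<open>- r v\<close> lets \<open>b \<partial>\<^sub>r\<close> act on the factor \<open>r ^ k\<close> as multiplication by \<open>- k v\<close>, and on
  functions of \<open>q = r\<^sup>2\<close> as \<open>- 2 v q \<partial>\<^sub>q\<close>.
\<close>

lemma transport_radial_power:
  assumes "has_partials T F" "\<And>t. t \<in> T \<Longrightarrow> at t within T \<noteq> bot" "radial_power k T f F"
    and "radial_power 0 T a g" "radial_power 1 T b (\<lambda>z q t. - v z q t)" "r > 0" "t \<in> T"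
  shows "transport T a b f z r t
    = r ^ k * (transport T g (\<lambda>z q t. - 2 * v z q t * q) F z (r\<^sup>2) t
        - real k * v z (r\<^sup>2) t * F z (r\<^sup>2) t)"
proof -
  have "a z r t = g z (r\<^sup>2) t" "b z r t = - r * v z (r\<^sup>2) t"
    using assms by (auto simp: radial_power_def)
  moreover have "D1 f z r t = r ^ k * D1 F z (r\<^sup>2) t" "Dt T f z r t = r ^ k * Dt T F z (r\<^sup>2) t"
    using radial_power_D1[OF assms(1,3)] radial_power_Dt[OF assms(1-3)] assms
    by (simp_all add: radial_power_def)
  moreover have "D2 f z r t
      = real k * r ^ (k - 1) * F z (r\<^sup>2) t + 2 * r ^ (k + 1) * D2 F z (r\<^sup>2) t"
    using radial_power_D2[OF assms(1,3,6,7)] .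
  ultimately show ?thesis
    by (cases k) (simp_all add: transport_def algebra_simps power2_eq_square)
qed

lemma D2_D2_radial_power_1:
  assumes "smooth_field T F" "\<And>t. t \<in> T \<Longrightarrow> at t within T \<noteq> bot" "radial_power 1 T f F"
    and "r > 0" "t \<in> T"
  shows "D2 (D2 f) z r t = 6 * r * D2 F z (r\<^sup>2) t + 4 * r ^ 3 * D2 (D2 F) z (r\<^sup>2) t"
proof (rule D2_eqI)
  have F: "has_partials T F" "has_partials T (D2 F)"
    using assms(1,2) by (simp_all add: smooth_field_has_partials smooth_field_D1_D2_Dt)
  show "D2 f z r t = F z (r\<^sup>2) t + 2 * r ^ 2 * D2 F z (r\<^sup>2) t" if "r > 0" for r
    using radial_power_D2[OF F(1) assms(3) that assms(5), of z]
    by (simp add: power2_eq_square)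
  note d = F[THEN has_derivative_radial, OF assms(4,5), of z]
  show "((\<lambda>r. F z (r\<^sup>2) t + 2 * r ^ 2 * D2 F z (r\<^sup>2) t) has_real_derivative
      6 * r * D2 F z (r\<^sup>2) t + 4 * r ^ 3 * D2 (D2 F) z (r\<^sup>2) t) (at r)"
    by (rule derivative_eq_intros d refl | simp add: algebra_simps power2_eq_square power3_eq_cube)+
qed fact

section \<open>The unified system\<close>

text \<open>
  What the two models share. The transport equations are those of the original fields \<open>s\<close> (the
  conserved quantity) and \<open>w\<close> (the vorticity quantity); dividing them by \<open>r ^ m\<^sup>2\<close> and
  \<open>r ^ (2 - m)\<close> gives the unified form. Every \<open>q > 0\<close> is reached as \<open>r\<^sup>2\<close> with \<open>r = sqrt q\<close>.
\<close>

lemma unified_systemI: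
  assumes T: "\<And>t. t \<in> T \<Longrightarrow> at t within T \<noteq> bot"
    and smooth: "smooth_field T u" "smooth_field T \<omega>" "smooth_field T g" "smooth_field T v"
    and velocity: "radial_power 0 T a g" "radial_power 1 T b (\<lambda>z q t. - v z q t)"
    and swirl: "radial_power (m\<^sup>2) T s (\<lambda>z q t. (u z q t)\<^sup>2)"
    and vorticity: "radial_power (2 - m) T w \<omega>" and "m \<le> 2"
    and eqs: "\<And>z r t. r > 0 \<Longrightarrow> t \<in> T \<Longrightarrow> transport T a b s z r t = 0"
      "\<And>z r t. r > 0 \<Longrightarrow> t \<in> T \<Longrightarrow>
        transport T a b w z r t = r ^ (2 - m) * D1 (\<lambda>z q t. (u z q t)\<^sup>2) z (r\<^sup>2) t"
      "\<And>z r t. r > 0 \<Longrightarrow> t \<in> T \<Longrightarrow>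
        \<omega> z (r\<^sup>2) t = - (D1 (D1 \<phi>) z (r\<^sup>2) t + 4 * r\<^sup>2 * D2 (D2 \<phi>) z (r\<^sup>2) t
          + (4 + 2 * real m) * D2 \<phi> z (r\<^sup>2) t)"
      "\<And>z r t. r > 0 \<Longrightarrow> t \<in> T \<Longrightarrow> v z (r\<^sup>2) t = D1 \<phi> z (r\<^sup>2) t"
      "\<And>z r t. r > 0 \<Longrightarrow> t \<in> T \<Longrightarrow>
        g z (r\<^sup>2) t = real m * \<phi> z (r\<^sup>2) t + 2 * r\<^sup>2 * D2 \<phi> z (r\<^sup>2) t"
  shows "unified_system m T u \<omega> \<phi> v g"
proof -
  let ?D = "transport T g (\<lambda>z q t. - 2 * v z q t * q)"
  have partials: "has_partials T u" "has_partials T \<omega>"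
    using smooth(1,2) T by (simp_all add: smooth_field_has_partials)
  have u2: "?D (\<lambda>z q t. (u z q t)\<^sup>2) z q t = (real m)\<^sup>2 * v z q t * (u z q t)\<^sup>2"
    if "q > 0" "t \<in> T" for z q t
    using eqs(1)[of "sqrt q" t z]
      transport_radial_power[OF has_partials_square[OF partials(1) T] T swirl velocity,
        of "sqrt q" t z] that by simp
  have \<omega>: "?D \<omega> z q t = D1 (\<lambda>z q t. (u z q t)\<^sup>2) z q t + (2 - real m) * v z q t * \<omega> z q t"
    if "q > 0" "t \<in> T" for z q t
    using eqs(2)[of "sqrt q" t z]
      transport_radial_power[OF partials(2) T vorticity velocity, of "sqrt q" t z] that \<open>m \<le> 2\<close>
    by (simp add: of_nat_diff)
  show ?thesis
    unfolding unified_system_def Let_def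
  proof (intro allI impI ballI conjI)
    fix z q t :: real
    assume qt: "q > 0" "t \<in> T"
    show "?D u z q t = (real m)\<^sup>2 / 2 * u z q t * v z q t"
      by (rule cancel_factor[OF T smooth(1,3,4) u2 qt])
    show "?D \<omega> z q t = D1 (\<lambda>z q t. (u z q t)\<^sup>2) z q t + (2 - real m) * v z q t * \<omega> z q t"
      by (rule \<omega>[OF qt])
    show "\<omega> z q t = - (D1 (D1 \<phi>) z q t + 4 * q * D2 (D2 \<phi>) z q t
        + (4 + 2 * real m) * D2 \<phi> z q t)"
      "v z q t = D1 \<phi> z q t" "g z q t = real m * \<phi> z q t + 2 * q * D2 \<phi> z q t"
      using eqs(3-5)[of "sqrt q" t z] qt by simp_all
  qed
qed

text \<open>
  The time derivative is unique at every point of the interval, endpoints included, because an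
  interval with more than one point has no isolated points.
\<close>

lemma interval_at_within_ne_bot:
  fixes T :: "real set"
  assumes "is_interval T" "interior T \<noteq> {}" "t \<in> T"
  shows "at t within T \<noteq> bot"
proof -
  have "T \<noteq> {a}" for a
    using assms(2) by auto
  then have "t islimpt T"
    using connected_imp_perfect[of T t] assms by (auto simp: is_interval_connected)
  then show ?thesis
    by (simp add: trivial_limit_within)
qed

text \<open>Here \<open>\<theta> = r u\<^sup>2\<close> and \<open>\<omega>\<tilde> = r \<omega>\<close>, the exponents \<open>m\<^sup>2\<close> and \<open>2 - m\<close> for \<open>m = 1\<close>.\<close>

lemma boussinesq_unified:
  assumes T: "\<And>t. t \<in> T \<Longrightarrow> at t within T \<noteq> bot"
    and smooth: "smooth_field T u" "smooth_field T \<omega>" "smooth_field T g" "smooth_field T v"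
      "smooth_field T \<phi>"
    and sys: "boussinesq_2d T \<theta> w \<psi> uz ur"
    and new: "radial_power 0 T uz g" "radial_power 1 T ur (\<lambda>z q t. - v z q t)"
      "radial_power 1 T \<theta> (\<lambda>z q t. (u z q t)\<^sup>2)" "radial_power 1 T w \<omega>" "radial_power 1 T \<psi> \<phi>"
  shows "unified_system 1 T u \<omega> \<phi> v g"
proof (rule unified_systemI[OF T smooth(1-4) new(1,2)])
  have \<phi>: "has_partials T \<phi>" "has_partials T (D1 \<phi>)"
    using smooth(5) T by (simp_all add: smooth_field_has_partials smooth_field_D1_D2_Dt)
  have u2: "has_partials T (\<lambda>z q t. (u z q t)\<^sup>2)"
    using smooth(1) T by (simp add: has_partials_square smooth_field_has_partials)
  note \<psi>z = radial_power_D1[OF \<phi>(1) new(5)]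
  show "radial_power (1\<^sup>2) T \<theta> (\<lambda>z q t. (u z q t)\<^sup>2)" "radial_power (2 - 1) T w \<omega>"
    using new(3,4) by simp_all
  fix z r t :: real
  assume rt: "r > 0" "t \<in> T"
  note s = sys[unfolded boussinesq_2d_def, rule_format, OF rt, of z]
  note n = new[unfolded radial_power_def, rule_format, OF rt, of z]
  show "transport T uz ur \<theta> z r t = 0"
    using s by blast
  show "transport T uz ur w z r t = r ^ (2 - 1) * D1 (\<lambda>z q t. (u z q t)\<^sup>2) z (r\<^sup>2) t"
    using s radial_power_D1[OF u2 new(3)] rt by (simp add: radial_power_def)
  have "r * \<omega> z (r\<^sup>2) t = r * - (D1 (D1 \<phi>) z (r\<^sup>2) t + 4 * r\<^sup>2 * D2 (D2 \<phi>) z (r\<^sup>2) t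
      + 6 * D2 \<phi> z (r\<^sup>2) t)"
    using s n radial_power_D1[OF \<phi>(2) \<psi>z] rt D2_D2_radial_power_1[OF smooth(5) T new(5) rt, of z]
    by (simp add: radial_power_def algebra_simps power2_eq_square power3_eq_cube)
  with rt show "\<omega> z (r\<^sup>2) t = - (D1 (D1 \<phi>) z (r\<^sup>2) t + 4 * r\<^sup>2 * D2 (D2 \<phi>) z (r\<^sup>2) t
      + (4 + 2 * real 1) * D2 \<phi> z (r\<^sup>2) t)"
    unfolding mult_left_cancel[OF less_imp_neq[OF rt(1), symmetric]] by simp
  show "v z (r\<^sup>2) t = D1 \<phi> z (r\<^sup>2) t"
    using s n \<psi>z rt by (simp add: radial_power_def)
  show "g z (r\<^sup>2) t = real 1 * \<phi> z (r\<^sup>2) t + 2 * r\<^sup>2 * D2 \<phi> z (r\<^sup>2) t"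
    using s n radial_power_D2[OF \<phi>(1) new(5) rt, of z] by (simp add: power2_eq_square)
qed simp_all

text \<open>
  Here \<open>(r v\<^sup>\<phi>)\<^sup>2 = r\<^sup>4 u\<^sup>2\<close> and \<open>\<omega>\<^sup>\<phi> / r = \<omega>\<close>, the exponents \<open>m\<^sup>2\<close> and \<open>2 - m\<close> for \<open>m = 2\<close>. The stream
  function enters both as \<open>\<psi>\<^sup>\<phi> = r \<phi>\<close> and, in the velocity, as \<open>r \<psi>\<^sup>\<phi> = r\<^sup>2 \<phi>\<close>.
\<close>

lemma axisym_euler_unified:
  assumes T: "\<And>t. t \<in> T \<Longrightarrow> at t within T \<noteq> bot"
    and smooth: "smooth_field T u" "smooth_field T \<omega>" "smooth_field T g" "smooth_field T v"
      "smooth_field T \<phi>"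
    and sys: "axisym_euler_3d T v\<phi> w\<phi> \<psi>\<phi> vz vr"
    and new: "radial_power 0 T vz g" "radial_power 1 T vr (\<lambda>z q t. - v z q t)"
      "radial_power 1 T v\<phi> u" "radial_power 1 T w\<phi> \<omega>" "radial_power 1 T \<psi>\<phi> \<phi>"
  shows "unified_system 2 T u \<omega> \<phi> v g"
proof (rule unified_systemI[OF T smooth(1-4) new(1,2)])
  have \<phi>: "has_partials T \<phi>" "has_partials T (D1 \<phi>)"
    using smooth(5) T by (simp_all add: smooth_field_has_partials smooth_field_D1_D2_Dt)
  have u2: "has_partials T (\<lambda>z q t. (u z q t)\<^sup>2)"
    using smooth(1) T by (simp add: has_partials_square smooth_field_has_partials)
  note \<psi>z = radial_power_D1[OF \<phi>(1) new(5)]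
  have swirl: "radial_power 4 T (\<lambda>z r t. (r * v\<phi> z r t)\<^sup>2) (\<lambda>z q t. (u z q t)\<^sup>2)"
    using new(3) by (simp add: radial_power_def power_mult_distrib flip: power_add)
  have r\<psi>: "radial_power 2 T (\<lambda>z r t. r * \<psi>\<phi> z r t) \<phi>"
    using new(5) by (simp add: radial_power_def power2_eq_square)
  show "radial_power (2\<^sup>2) T (\<lambda>z r t. (r * v\<phi> z r t)\<^sup>2) (\<lambda>z q t. (u z q t)\<^sup>2)"
    using swirl by simp
  show "radial_power (2 - 2) T (\<lambda>z r t. 1 / r * w\<phi> z r t) \<omega>"
    using new(4) by (simp add: radial_power_def)
  fix z r t :: real
  assume rt: "r > 0" "t \<in> T"
  note s = sys[unfolded axisym_euler_3d_def, rule_format, OF rt, of z]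
  note n = new[unfolded radial_power_def, rule_format, OF rt, of z]
  show "transport T vz vr (\<lambda>z r t. (r * v\<phi> z r t)\<^sup>2) z r t = 0"
    using s by blast
  show "transport T vz vr (\<lambda>z r t. 1 / r * w\<phi> z r t) z r t
      = r ^ (2 - 2) * D1 (\<lambda>z q t. (u z q t)\<^sup>2) z (r\<^sup>2) t"
    using s radial_power_D1[OF u2 swirl] rt by (simp add: radial_power_def)
  have "r * \<omega> z (r\<^sup>2) t = w\<phi> z r t"
    using n by simp
  also have "\<dots> = - (D1 (D1 \<psi>\<phi>) z r t + D2 (D2 \<psi>\<phi>) z r t
      + 1 / r * D2 \<psi>\<phi> z r t - 1 / r\<^sup>2 * \<psi>\<phi> z r t)"
    using s by blast
  also have "\<dots> = - (r * D1 (D1 \<phi>) z (r\<^sup>2) t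
      + (6 * r * D2 \<phi> z (r\<^sup>2) t + 4 * r ^ 3 * D2 (D2 \<phi>) z (r\<^sup>2) t)
      + 1 / r * (\<phi> z (r\<^sup>2) t + 2 * r\<^sup>2 * D2 \<phi> z (r\<^sup>2) t) - 1 / r\<^sup>2 * (r * \<phi> z (r\<^sup>2) t))"
    using n radial_power_D1[OF \<phi>(2) \<psi>z] rt D2_D2_radial_power_1[OF smooth(5) T new(5) rt, of z]
      radial_power_D2[OF \<phi>(1) new(5) rt, of z]
    by (simp add: radial_power_def power2_eq_square)
  also have "\<dots> = r * - (D1 (D1 \<phi>) z (r\<^sup>2) t + 4 * r\<^sup>2 * D2 (D2 \<phi>) z (r\<^sup>2) t
      + 8 * D2 \<phi> z (r\<^sup>2) t)"
    using \<open>r > 0\<close> by (simp add: field_simps power2_eq_square power3_eq_cube)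
  finally have "r * \<omega> z (r\<^sup>2) t = r * - (D1 (D1 \<phi>) z (r\<^sup>2) t + 4 * r\<^sup>2 * D2 (D2 \<phi>) z (r\<^sup>2) t
      + 8 * D2 \<phi> z (r\<^sup>2) t)" .
  with rt show "\<omega> z (r\<^sup>2) t = - (D1 (D1 \<phi>) z (r\<^sup>2) t + 4 * r\<^sup>2 * D2 (D2 \<phi>) z (r\<^sup>2) t
      + (4 + 2 * real 2) * D2 \<phi> z (r\<^sup>2) t)"
    unfolding mult_left_cancel[OF less_imp_neq[OF rt(1), symmetric]] by simp
  have "- r * v z (r\<^sup>2) t = - (1 / r) * (r\<^sup>2 * D1 \<phi> z (r\<^sup>2) t)"
    using s n radial_power_D1[OF \<phi>(1) r\<psi>] rt by (simp add: radial_power_def)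
  then show "v z (r\<^sup>2) t = D1 \<phi> z (r\<^sup>2) t"
    using \<open>r > 0\<close> by (simp add: power2_eq_square)
  have "g z (r\<^sup>2) t = 1 / r * (2 * r * \<phi> z (r\<^sup>2) t + 2 * r ^ 3 * D2 \<phi> z (r\<^sup>2) t)"
    using s n radial_power_D2[OF \<phi>(1) r\<psi> rt, of z] by simp
  also have "\<dots> = real 2 * \<phi> z (r\<^sup>2) t + 2 * r\<^sup>2 * D2 \<phi> z (r\<^sup>2) t"
    using \<open>r > 0\<close> by (simp add: field_simps power2_eq_square power3_eq_cube)
  finally show "g z (r\<^sup>2) t = real 2 * \<phi> z (r\<^sup>2) t + 2 * r\<^sup>2 * D2 \<phi> z (r\<^sup>2) t" .
qed simp_all

theorem theorem2p1:
  fixes T :: "real set"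
  assumes "is_interval T" and "interior T \<noteq> {}"
  shows
    "(\<forall>\<theta> w \<psi> uz ur v u \<omega> \<phi> g.
        (\<forall>f\<in>{\<theta>, w, \<psi>, uz, ur, v, u, \<omega>, \<phi>, g}. smooth_field T f) \<longrightarrow>
        boussinesq_2d T \<theta> w \<psi> uz ur \<longrightarrow>
        (\<forall>z. \<forall>r>0. \<forall>t\<in>T.
           v z (r\<^sup>2) t = - (1 / r) * ur z r t \<and>
           (u z (r\<^sup>2) t)\<^sup>2 = 1 / r * \<theta> z r t \<and>
           \<omega> z (r\<^sup>2) t = 1 / r * w z r t \<and>
           \<phi> z (r\<^sup>2) t = 1 / r * \<psi> z r t \<and>
           g z (r\<^sup>2) t = uz z r t) \<longrightarrow>
        unified_system 1 T u \<omega> \<phi> v g)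
     \<and>
     (\<forall>v\<phi> w\<phi> \<psi>\<phi> vz vr v u \<omega> \<phi> g.
        (\<forall>f\<in>{v\<phi>, w\<phi>, \<psi>\<phi>, vz, vr, v, u, \<omega>, \<phi>, g}. smooth_field T f) \<longrightarrow>
        axisym_euler_3d T v\<phi> w\<phi> \<psi>\<phi> vz vr \<longrightarrow>
        (\<forall>z. \<forall>r>0. \<forall>t\<in>T.
           v z (r\<^sup>2) t = - (1 / r) * vr z r t \<and>
           u z (r\<^sup>2) t = 1 / r * v\<phi> z r t \<and>
           \<omega> z (r\<^sup>2) t = 1 / r * w\<phi> z r t \<and>
           \<phi> z (r\<^sup>2) t = 1 / r * \<psi>\<phi> z r t \<and>
           g z (r\<^sup>2) t = vz z r t) \<longrightarrow>
        unified_system 2 T u \<omega> \<phi> v g)"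
proof (intro conjI allI impI)
  have T: "at t within T \<noteq> bot" if "t \<in> T" for t
    using interval_at_within_ne_bot[OF assms that] .
  {
    fix \<theta> w \<psi> uz ur v u \<omega> \<phi> g :: field
    assume "\<forall>f\<in>{\<theta>, w, \<psi>, uz, ur, v, u, \<omega>, \<phi>, g}. smooth_field T f"
      and sys: "boussinesq_2d T \<theta> w \<psi> uz ur"
      and "\<forall>z. \<forall>r>0. \<forall>t\<in>T. v z (r\<^sup>2) t = - (1 / r) * ur z r t \<and>
           (u z (r\<^sup>2) t)\<^sup>2 = 1 / r * \<theta> z r t \<and> \<omega> z (r\<^sup>2) t = 1 / r * w z r t \<and>
           \<phi> z (r\<^sup>2) t = 1 / r * \<psi> z r t \<and> g z (r\<^sup>2) t = uz z r t"
    then show "unified_system 1 T u \<omega> \<phi> v g"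
      by (intro boussinesq_unified[OF T _ _ _ _ _ sys]) (simp_all add: radial_power_def)
  }
  fix v\<phi> w\<phi> \<psi>\<phi> vz vr v u \<omega> \<phi> g :: field
  assume "\<forall>f\<in>{v\<phi>, w\<phi>, \<psi>\<phi>, vz, vr, v, u, \<omega>, \<phi>, g}. smooth_field T f"
    and sys: "axisym_euler_3d T v\<phi> w\<phi> \<psi>\<phi> vz vr"
    and "\<forall>z. \<forall>r>0. \<forall>t\<in>T. v z (r\<^sup>2) t = - (1 / r) * vr z r t \<and>
         u z (r\<^sup>2) t = 1 / r * v\<phi> z r t \<and> \<omega> z (r\<^sup>2) t = 1 / r * w\<phi> z r t \<and>
         \<phi> z (r\<^sup>2) t = 1 / r * \<psi>\<phi> z r t \<and> g z (r\<^sup>2) t = vz z r t"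
  then show "unified_system 2 T u \<omega> \<phi> v g"
    by (intro axisym_euler_unified[OF T _ _ _ _ _ sys]) (simp_all add: radial_power_def)
qed

end
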